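(* For a string $T$ of length $n > d$ over an alphabet $\Sigma$ of size $\sigma$, $$\mathcal{S}(T,d) \in O(\min\{d,\sigma\}\, n),$$ that is, there is an absolute constant $C$ with $\mathcal{S}(T,d) \le C\min\{d,\sigma\}\,n$ for all such $T$, $d$, $\sigma$. This upper bound is tight when $n-d \in \Omega(n)$; that is, for every constant $c \in (0,1)$ there is a constant $c' > 0$ such that for all positive integers $\sigma, d, n$ with $d < n$ and $n-d \ge c\,n$, there exists a string $T$ of length $n$ over an alphabet of size $\sigma$ with $$\mathcal{S}(T,d) \ge c' \min\{d,\sigma\}\, n.$$
   Context: Strings are finite sequences over a finite alphabet $\Sigma$; positions are 1-indexed and $T[i..j]$ denotes the substring of $T$ from position $i$ to position $j$. A string $w$ occurs in $S$ if it is a (contiguous) substring of $S$; the empty string occurs in every string. A non-empty string $w \in \Sigma^*$ is a minimal absent word (MAW) for $S$ if $w$ does not occur in $S$ but every proper substring of $w$ occurs in $S$ (in particular a single character of $\Sigma$ not occurring in $S$ is a MAW for $S$). $\mathsf{MAW}(S)$ is the set of all MAWs for $S$ relative to $\Sigma$. $\bigtriangleup$ denotes symmetric difference. For a string $T$ of length $n$ and window length $d$ with $1 \le d < n$, $$\mathcal{S}(T,d) = \sum_{i=1}^{n-d} |\mathsf{MAW}(T[i..i+d-1]) \bigtriangleup \mathsf{MAW}(T[i+1..i+d])|.$$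
   Formalization: The lower bound is stated for σ ≥ 2 instead of all positive σ, since for σ = 1 all windows coincide, S(T,d) = 0 and the claim is false (e.g. T = aa, d = 1, n = 2); alphabets are finite sets of natural numbers, which covers every finite alphabet up to renaming letters. *)

theory Defs
  imports Complex_Main "HOL-Library.Sublist"
begin

text \<open>The substring of \<open>T\<close> from position \<open>i\<close> to position \<open>j\<close>, with 1-indexed positions
  and both ends included; it is used for \<open>1 \<le> i\<close> only.\<close>

definition substring :: "'a list \<Rightarrow> nat \<Rightarrow> nat \<Rightarrow> 'a list" where
  "substring T i j = take (Suc j - i) (drop (i - 1) T)"

text \<open>\<^const>\<open>sublist\<close> is the contiguous-substring relation (non-contiguous
  subsequences are called \<^const>\<open>subseq\<close> in the library).\<close>

definition MAW :: "'a set \<Rightarrow> 'a list \<Rightarrow> 'a list set" where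
  "MAW \<Sigma> S = {w \<in> lists \<Sigma>. w \<noteq> [] \<and> \<not> sublist w S \<and> (\<forall>u. strict_sublist u w \<longrightarrow> sublist u S)}"

definition total_MAW_changes :: "'a set \<Rightarrow> 'a list \<Rightarrow> nat \<Rightarrow> nat" where
  "total_MAW_changes \<Sigma> T d =
     (\<Sum>i = 1..length T - d.
        card (sym_diff (MAW \<Sigma> (substring T i (i + d - 1))) (MAW \<Sigma> (substring T (i + 1) (i + d)))))"

text \<open>The sets whose cardinality is taken are finite.\<close>

lemma finite_MAW:
  assumes "finite \<Sigma>"
  shows "finite (MAW \<Sigma> S)"
proof (rule finite_subset)
  show "MAW \<Sigma> S \<subseteq> {w. set w \<subseteq> \<Sigma> \<and> length w \<le> Suc (length S)}"
  proof
    fix w assume w: "w \<in> MAW \<Sigma> S"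
    then obtain a v where v: "w = a # v" by (cases w) (auto simp: MAW_def)
    have "strict_sublist v w" by (simp add: v strict_sublist_def sublist_Cons_right)
    with w have "sublist v S" by (auto simp: MAW_def)
    then have "length v \<le> length S" by (rule sublist_length_le)
    with w v show "w \<in> {w. set w \<subseteq> \<Sigma> \<and> length w \<le> Suc (length S)}" by (auto simp: MAW_def)
  qed
  show "finite {w. set w \<subseteq> \<Sigma> \<and> length w \<le> Suc (length S)}"
    using assms by (rule finite_lists_length_le)
qed

end

theory Submission
  imports Defs
begin

text \<open>Upper bound. Sliding the window is an append followed by a deletion, and deletions in \<open>T\<close> are
  appends in the reversal of \<open>T\<close>. Appending \<open>x\<close> to \<open>S\<close> destroys at most one minimal absent word,
  and creates at most one per letter in addition to the words \<open>a u x\<close> where \<open>u\<close> is a suffix of \<open>S\<close>,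
  \<open>u x\<close> is new and \<open>a u\<close> occurs in \<open>S\<close> only elsewhere. Such a word is determined by the end
  position of an occurrence of \<open>a u\<close>, which gives the bound in \<open>d\<close>. Moreover \<open>u\<close> is then preceded
  by two different letters in \<open>S\<close>; the number of suffixes with this property grows by at most one per
  append, and drops by the number of those for which \<open>u x\<close> is new, so that there are
  \<open>O(n)\<close> such \<open>u\<close> in total, which gives the bound in \<open>\<sigma>\<close>.

  Lower bound. For bounded \<open>min d \<sigma>\<close> it suffices that consecutive windows differ, as in
  \<open>0101\<dots>\<close>. Otherwise take \<open>1 0\<^sup>k 2 0\<^sup>k \<dots>\<close> with markers cycling through \<open>\<sigma> - 1\<close> letters, so
  spaced that the window is just shorter than a cycle: when the marker \<open>a\<close> leaves the window, all words
  \<open>a 0\<^sup>j b\<close> with \<open>j \<le> k\<close> and \<open>b\<close> a later marker in the window, other than the next one,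
  cease to be minimal absent words.\<close>

section \<open>Minimal absent words in terms of their two maximal proper factors, and their
  behaviour under reversal\<close>

lemma strict_sublist_Cons_snoc:
  "strict_sublist v (a # u @ [b]) \<longleftrightarrow> sublist v (a # u) \<or> sublist v (u @ [b])"
proof
  assume "strict_sublist v (a # u @ [b])"
  then obtain ps ss where e: "a # u @ [b] = ps @ v @ ss" and ne: "v \<noteq> a # u @ [b]"
    by (auto simp: strict_sublist_def sublist_def)
  show "sublist v (a # u) \<or> sublist v (u @ [b])"
  proof (cases ps)
    case Nil
    with e ne obtain ss' c where "ss = ss' @ [c]" by (cases ss rule: rev_cases) auto
    with e Nil have "(a # u) @ [b] = (v @ ss') @ [c]" by simp
    then have "a # u = v @ ss'" by (metis butlast_snoc)
    then show ?thesis by simp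
  next
    case (Cons c ps')
    with e have "u @ [b] = ps' @ v @ ss" by simp
    then show ?thesis by simp
  qed
next
  assume *: "sublist v (a # u) \<or> sublist v (u @ [b])"
  have "sublist (a # u) (a # u @ [b])" "sublist (u @ [b]) (a # u @ [b])"
    by (metis append_Cons sublist_append_rightI) (simp add: sublist_Cons_right)
  with * have "sublist v (a # u @ [b])" using sublist_order.order_trans by blast
  moreover have "length v < length (a # u @ [b])"
    using * by (auto dest: sublist_length_le)
  ultimately show "strict_sublist v (a # u @ [b])" by (auto simp: strict_sublist_def)
qed

lemma sublist_singleton_iff: "sublist [b] S \<longleftrightarrow> b \<in> set S"
  by (auto simp: sublist_def in_set_conv_decomp)

lemma MAW_singleton_iff: "[b] \<in> MAW \<Sigma> S \<longleftrightarrow> b \<in> \<Sigma> \<and> b \<notin> set S"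
proof -
  have "strict_sublist v [b] \<longleftrightarrow> v = []" for v
    by (cases v) (auto simp: strict_sublist_def sublist_Cons_right)
  then show ?thesis by (simp add: MAW_def sublist_singleton_iff)
qed

text \<open>A proper factor misses the first or the last letter, so minimality comes down to the
  occurrence of two factors.\<close>

lemma MAW_Cons_snoc_iff:
  "a # u @ [b] \<in> MAW \<Sigma> S \<longleftrightarrow> a # u @ [b] \<in> lists \<Sigma> \<and> \<not> sublist (a # u @ [b]) S \<and>
     sublist (a # u) S \<and> sublist (u @ [b]) S"
proof -
  have "(\<forall>v. sublist v (a # u) \<or> sublist v (u @ [b]) \<longrightarrow> sublist v S) \<longleftrightarrow>
      sublist (a # u) S \<and> sublist (u @ [b]) S"
    using sublist_order.order_refl sublist_order.order_trans by metis
  then show ?thesis by (simp add: MAW_def strict_sublist_Cons_snoc)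
qed

lemma MAW_cases:
  assumes "w \<in> MAW \<Sigma> S"
  obtains b where "w = [b]" | a u b where "w = a # u @ [b]"
proof (cases w)
  case Nil
  with assms show ?thesis by (simp add: MAW_def)
next
  case (Cons a v)
  then show ?thesis using that by (cases v rule: rev_cases) auto
qed

lemma MAW_rev: "MAW \<Sigma> (rev S) = rev ` MAW \<Sigma> S"
proof -
  have strict: "strict_sublist (rev u) w \<longleftrightarrow> strict_sublist u (rev w)" for u w :: "'a list"
    by (metis rev_rev_ident strict_sublist_def sublist_rev)
  have "rev w \<in> MAW \<Sigma> (rev S) \<longleftrightarrow> w \<in> MAW \<Sigma> S" for w and S :: "'a list"
    unfolding MAW_def by (auto simp: strict) (metis rev_rev_ident strict sublist_rev)+
  then show ?thesis by (force intro: image_eqI[where x = "rev w" for w])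
qed

lemma card_sym_diff_rev:
  "card (sym_diff (rev ` A) (rev ` B)) = card (sym_diff A B)"
proof -
  have inj: "inj rev" by (simp add: inj_on_def)
  have "sym_diff (rev ` A) (rev ` B) = rev ` (sym_diff A B)"
    by (simp only: image_Un image_set_diff[OF inj])
  then show ?thesis using card_image[OF inj_on_subset[OF inj subset_UNIV]] by simp
qed

lemma card_sym_diff_triangle:
  assumes "finite A" "finite B" "finite C"
  shows "card (sym_diff A C) \<le> card (sym_diff A B) + card (sym_diff B C)"
proof -
  have "sym_diff A C \<subseteq> sym_diff A B \<union> sym_diff B C" by blast
  then have "card (sym_diff A C) \<le> card (sym_diff A B \<union> sym_diff B C)"
    using assms by (intro card_mono) auto
  then show ?thesis using card_Un_le le_trans by blast
qed

section \<open>Appending a letter\<close>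

text \<open>The cardinality of this set is the potential in the amortised bound in
  \<open>\<sigma>\<close>.\<close>

definition left_special_suffixes :: "'a list \<Rightarrow> 'a list set" where
  "left_special_suffixes S =
     {u. suffix u S \<and> (\<exists>a c. a \<noteq> c \<and> sublist (a # u) S \<and> sublist (c # u) S)}"

definition fresh_special :: "'a list \<Rightarrow> 'a \<Rightarrow> 'a list set" where
  "fresh_special S x = {u \<in> left_special_suffixes S. \<not> sublist (u @ [x]) S}"

text \<open>Candidates for words that become minimal absent because \<open>u @ [x]\<close> starts to
  occur; \<open>\<not> suffix (a # u) S\<close> keeps \<open>a # u @ [x]\<close> itself absent from
  \<open>S @ [x]\<close>.\<close>

definition fresh_extensions :: "'a list \<Rightarrow> 'a \<Rightarrow> 'a list set" where
  "fresh_extensions S x = {a # u @ [x] | a u.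
     suffix u S \<and> \<not> sublist (u @ [x]) S \<and> sublist (a # u) S \<and> \<not> suffix (a # u) S}"

lemma finite_left_special_suffixes: "finite (left_special_suffixes S)"
  by (rule finite_subset[of _ "set (suffixes S)"]) (auto simp: left_special_suffixes_def)

lemma card_left_special_suffixes: "card (left_special_suffixes S) \<le> Suc (length S)"
proof -
  have "left_special_suffixes S \<subseteq> set (suffixes S)" by (auto simp: left_special_suffixes_def)
  from card_mono[OF _ this] show ?thesis by simp
qed

lemma left_special_suffixes_tl: "left_special_suffixes (tl S) \<subseteq> left_special_suffixes S"
proof -
  have "suffix u (tl S) \<Longrightarrow> suffix u S" "sublist u (tl S) \<Longrightarrow> sublist u S" for u
    using suffix_order.order_trans suffix_tl sublist_order.order_trans sublist_tl by blast+
  then show ?thesis unfolding left_special_suffixes_def by blast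
qed

text \<open>Let \<open>u @ [x]\<close> be preceded by \<open>a\<close> and \<open>c\<close> in
  \<open>S @ [x]\<close>. At most one of these two occurrences ends at the new letter, so the other
  lies inside \<open>S\<close>. Hence \<open>u @ [x]\<close> is not new, and dropping
  \<open>x\<close> leaves a left special suffix of \<open>S\<close>.\<close>

lemma left_special_suffixes_snoc:
  "left_special_suffixes (S @ [x]) \<subseteq>
     insert [] ((\<lambda>u. u @ [x]) ` (left_special_suffixes S - fresh_special S x))"
proof
  fix v assume "v \<in> left_special_suffixes (S @ [x])"
  then obtain a c where v: "suffix v (S @ [x])" "a \<noteq> c"
      "sublist (a # v) (S @ [x])" "sublist (c # v) (S @ [x])"
    by (auto simp: left_special_suffixes_def)
  show "v \<in> insert [] ((\<lambda>u. u @ [x]) ` (left_special_suffixes S - fresh_special S x))"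
  proof (cases "v = []")
    case False
    with v obtain u where u: "v = u @ [x]" "suffix u S" by auto
    have ext: "suffix (b # u) S \<or> sublist (b # u @ [x]) S" if "sublist (b # v) (S @ [x])" for b
      using that snoc_sublist_snoc[of "b # u" x S x] u by simp
    have sub: "sublist (b # u) S" "sublist (u @ [x]) S" if "sublist (b # u @ [x]) S" for b
      using that strict_sublist_Cons_snoc[of _ b u x] sublist_order.order_trans
      by (metis strict_sublist_def sublist_order.order_refl)+
    have "\<not> (suffix (a # u) S \<and> suffix (c # u) S)"
      using v(2) by (metis length_Cons list.inject order_refl suffix_length_suffix suffix_order.antisym)
    with ext[OF v(3)] ext[OF v(4)] sub have "sublist (u @ [x]) S" by blast
    moreover have "u \<in> left_special_suffixes S"
      using v(2) u(2) ext[OF v(3)] ext[OF v(4)] sub unfolding left_special_suffixes_def by blast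
    ultimately show ?thesis using u by (auto simp: fresh_special_def)
  qed simp
qed

text \<open>The amortisation step for one full slide, \<open>tl (S @ [x])\<close> being the next
  window. The empty word accounts for the \<open>+ 1\<close>.\<close>

lemma card_fresh_special:
  "card (fresh_special S x) + card (left_special_suffixes (tl (S @ [x])))
     \<le> card (left_special_suffixes S) + 1"
proof -
  let ?L = "left_special_suffixes S" and ?F = "fresh_special S x"
  have fin: "finite ?L" "?F \<subseteq> ?L"
    by (auto simp: finite_left_special_suffixes fresh_special_def)
  have "left_special_suffixes (tl (S @ [x])) \<subseteq> insert [] ((\<lambda>u. u @ [x]) ` (?L - ?F))"
    by (rule subset_trans[OF left_special_suffixes_tl left_special_suffixes_snoc])
  then have "card (left_special_suffixes (tl (S @ [x]))) \<le> card (insert [] ((\<lambda>u. u @ [x]) ` (?L - ?F)))"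
    using fin by (intro card_mono) auto
  also have "\<dots> \<le> Suc (card ((\<lambda>u. u @ [x]) ` (?L - ?F)))" by (rule card_insert_le_m1) auto
  also have "\<dots> \<le> Suc (card (?L - ?F))"
    using fin by (simp add: card_image_le)
  also have "card (?L - ?F) = card ?L - card ?F"
    using fin by (intro card_Diff_subset) (auto intro: finite_subset)
  finally show ?thesis using card_mono[OF fin] by simp
qed

text \<open>If \<open>a u\<close> and \<open>b v\<close> end at the same position and \<open>u\<close> is shorter than \<open>v\<close>, then \<open>a u\<close> is a
  suffix of \<open>v\<close> and hence of \<open>S\<close>.\<close>

lemma fresh_extensions_subset_image:
  "fresh_extensions S x \<subseteq> (\<lambda>e. (THE w. \<exists>a u. w = a # u @ [x] \<and> suffix u S \<and>
     suffix (a # u) (take e S) \<and> \<not> suffix (a # u) S)) ` {1..length S}"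
    (is "_ \<subseteq> ?f ` _")
proof
  fix w assume "w \<in> fresh_extensions S x"
  then obtain a u where w: "w = a # u @ [x]" "suffix u S" "sublist (a # u) S" "\<not> suffix (a # u) S"
    by (auto simp: fresh_extensions_def)
  then obtain p where p: "prefix p S" "suffix (a # u) p" by (auto simp: sublist_altdef)
  define e where "e = length p"
  have pe: "take e S = p" and e: "e \<in> {1..length S}"
    using p unfolding e_def
    by (auto simp: prefix_def suffix_def)
  have unique: "a' # u' @ [x] = w"
    if "suffix u' S" "suffix (a' # u') p" "\<not> suffix (a' # u') S" for a' u'
  proof -
    have *: False if "suffix (b # v) p" "suffix (c # y) p" "length v < length y" "suffix y S"
      "\<not> suffix (b # v) S" for b c v y
    proof -
      have "suffix y p" using that(2) by (rule suffix_ConsD)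
      with that(1) have "suffix (b # v) y" by (rule suffix_length_suffix) (use that(3) in simp)
      then show False using that(4,5) suffix_order.order_trans by blast
    qed
    have "length u = length u'"
      using *[OF p(2) that(2)] *[OF that(2) p(2)] w that by (metis linorder_neqE_nat)
    then have "a # u = a' # u'"
      using p(2) that(2)
      by (metis length_Cons order_refl suffix_length_suffix suffix_order.antisym)
    then show ?thesis using w by simp
  qed
  \<comment> \<open>At end positions without such a word \<open>THE\<close> is arbitrary, which is
    harmless because only an inclusion is claimed.\<close>
  have "?f e = w"
    unfolding pe using w p(2) unique by (intro the_equality) blast+
  with e show "w \<in> ?f ` {1..length S}" by blast
qed

lemma finite_fresh_extensions: "finite (fresh_extensions S x)"
  by (rule finite_subset[OF fresh_extensions_subset_image]) (rule finite_imageI, rule finite_atLeastAtMost)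

lemma card_fresh_extensions_le_length: "card (fresh_extensions S x) \<le> length S"
proof -
  have "card (fresh_extensions S x) \<le> card {1..length S}"
    by (rule surj_card_le[OF _ fresh_extensions_subset_image]) (rule finite_atLeastAtMost)
  then show ?thesis by (simp only: card_atLeastAtMost diff_Suc_1)
qed

text \<open>Since \<open>a # u\<close> occurs in \<open>S\<close>, \<open>u\<close> is a proper
  suffix and is preceded by some \<open>c\<close> at the end of \<open>S\<close>. As
  \<open>a # u\<close> is no suffix, \<open>a \<noteq> c\<close>, so \<open>u\<close> is left
  special; \<open>a\<close> has at most \<open>card \<Sigma>\<close> values.\<close>

lemma card_fresh_extensions_le_special:
  assumes "finite \<Sigma>" "S \<in> lists \<Sigma>"
  shows "card (fresh_extensions S x) \<le> card \<Sigma> * card (fresh_special S x)"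
proof -
  have fin: "finite (fresh_special S x)"
    by (rule finite_subset[OF _ finite_left_special_suffixes[of S]]) (auto simp: fresh_special_def)
  have "fresh_extensions S x \<subseteq> (\<lambda>(a, u). a # u @ [x]) ` (\<Sigma> \<times> fresh_special S x)"
  proof
    fix w assume "w \<in> fresh_extensions S x"
    then obtain a u where w: "w = a # u @ [x]" "suffix u S" "\<not> sublist (u @ [x]) S"
        "sublist (a # u) S" "\<not> suffix (a # u) S"
      by (auto simp: fresh_extensions_def)
    have "u \<noteq> S" using w(4) sublist_length_le by fastforce
    with w(2) obtain c where c: "suffix (c # u) S"
      by (metis append_Nil append_assoc rev_exhaust suffix_def append_Cons)
    with w have "a \<noteq> c" by blast
    with w c have "u \<in> fresh_special S x"
      by (auto simp: fresh_special_def left_special_suffixes_def)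
    moreover have "a \<in> \<Sigma>" using w(4) assms(2) by (auto dest: set_mono_sublist)
    ultimately show "w \<in> (\<lambda>(a, u). a # u @ [x]) ` (\<Sigma> \<times> fresh_special S x)" using w by force
  qed
  from surj_card_le[OF _ this] show ?thesis using fin assms by (simp add: card_cartesian_product)
qed

section \<open>Words removed and words added by one append\<close>

lemma MAW_snoc_removed:
  assumes "w \<in> MAW \<Sigma> S - MAW \<Sigma> (S @ [x])"
  shows "suffix w (S @ [x])" "\<not> sublist w S" "\<And>v. strict_sublist v w \<Longrightarrow> sublist v S"
  using assms by (auto simp: MAW_def sublist_snoc)

text \<open>Suffixes of the same string are comparable; were they different, the shorter would be a
  proper factor of the longer and hence occur in \<open>S\<close>.\<close>

lemma minimal_new_suffix_unique:
  assumes "suffix v X" "\<not> sublist v S" "\<And>u. strict_sublist u v \<Longrightarrow> sublist u S"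
    and "suffix w X" "\<not> sublist w S" "\<And>u. strict_sublist u w \<Longrightarrow> sublist u S"
  shows "v = w"
  using suffix_same_cases[OF assms(1,4)]
proof
  assume "suffix v w"
  then show ?thesis using assms(2) assms(6)[of v] by (auto simp: strict_sublist_def)
next
  assume "suffix w v"
  then show ?thesis using assms(5) assms(3)[of w] by (auto simp: strict_sublist_def)
qed

lemma card_removed: "card (MAW \<Sigma> S - MAW \<Sigma> (S @ [x])) \<le> 1"
proof (cases "MAW \<Sigma> S - MAW \<Sigma> (S @ [x]) = {}")
  case False
  then obtain w where w: "w \<in> MAW \<Sigma> S - MAW \<Sigma> (S @ [x])" by blast
  have "v = w" if "v \<in> MAW \<Sigma> S - MAW \<Sigma> (S @ [x])" for v
    by (rule minimal_new_suffix_unique[OF MAW_snoc_removed[OF that] MAW_snoc_removed[OF w]])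
  with w have "MAW \<Sigma> S - MAW \<Sigma> (S @ [x]) = {w}" by blast
  then show ?thesis by simp
qed (simp only: card.empty)

text \<open>If \<open>a # u @ [b]\<close> is added, then \<open>a # u\<close> or
  \<open>u @ [b]\<close> is new. If only the latter is, then \<open>b = x\<close> and the word is a
  fresh extension. Otherwise \<open>a # u\<close> is a fixed word \<open>v\<close>, and only the
  letter \<open>b\<close> is free.\<close>

lemma MAW_snoc_added:
  "\<exists>v. MAW \<Sigma> (S @ [x]) - MAW \<Sigma> S \<subseteq>
     fresh_extensions S x \<union> (\<lambda>b. v @ [b]) ` set (S @ [x])"
proof -
  define P where "P a u \<longleftrightarrow> suffix (a # u) (S @ [x]) \<and> \<not> sublist (a # u) S \<and> sublist u S" for a u
  \<comment> \<open>\<open>P a u\<close> makes \<open>a # u\<close> the shortest suffix of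
    \<open>S @ [x]\<close> that does not occur in \<open>S\<close>.\<close>
  have P_unique: "a # u = a' # u'" if "P a u" "P a' u'" for a u a' u'
  proof -
    have *: "sublist v S" if "P b y" "strict_suffix v (b # y)" for b v y
    proof -
      have "suffix v y" using that(2) by (auto simp: strict_suffix_def suffix_Cons)
      then show ?thesis using that(1) unfolding P_def
        using suffix_imp_sublist sublist_order.order_trans by blast
    qed
    have "suffix (a # u) (a' # u') \<or> suffix (a' # u') (a # u)"
      using that unfolding P_def by (meson suffix_same_cases)
    then show ?thesis using that *[OF that(1)] *[OF that(2)]
      by (metis P_def strict_suffix_def)
  qed
  have added: "w \<in> fresh_extensions S x \<or> (\<exists>a u b. w = a # u @ [b] \<and> P a u \<and> b \<in> set (S @ [x]))"
    if w: "w \<in> MAW \<Sigma> (S @ [x])" "w \<notin> MAW \<Sigma> S" for w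
    using w(1)
  proof (cases rule: MAW_cases)
    \<comment> \<open>A letter absent from \<open>S @ [x]\<close> was already absent from
      \<open>S\<close>, so one-letter words are never added.\<close>
    case (1 b)
    then show ?thesis using w by (simp add: MAW_singleton_iff)
  next
    case (2 a u b)
    with w have m: "a # u @ [b] \<in> lists \<Sigma>" "\<not> sublist (a # u @ [b]) (S @ [x])"
        "sublist (a # u) (S @ [x])" "sublist (u @ [b]) (S @ [x])"
      by (simp_all add: MAW_Cons_snoc_iff)
    have "\<not> sublist (a # u @ [b]) S" using m(2) by (metis sublist_snoc)
    with 2 w m(1) have new: "\<not> sublist (a # u) S \<or> \<not> sublist (u @ [b]) S"
      by (simp add: MAW_Cons_snoc_iff)
    show ?thesis
    proof (cases "sublist (a # u) S")
      case True
      with new m(4) have "b = x" "suffix u S" "\<not> sublist (u @ [x]) S"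
        by (auto simp: snoc_sublist_snoc)
      moreover from this m(2) have "\<not> suffix (a # u) S"
        using snoc_sublist_snoc[of "a # u" x S x] by simp
      ultimately show ?thesis using 2 True by (auto simp: fresh_extensions_def)
    next
      case False
      have "sublist u S"
      proof -
        from m(4) have "suffix u S \<or> sublist (u @ [b]) S" by (auto simp: snoc_sublist_snoc)
        then show ?thesis using sublist_order.order_trans sublist_append_rightI by blast
      qed
      with False m(3) have "P a u" by (auto simp: P_def sublist_snoc)
      moreover have "b \<in> set (S @ [x])" using set_mono_sublist[OF m(4)] by auto
      ultimately show ?thesis using 2 by blast
    qed
  qed
  show ?thesis
  proof (cases "\<exists>a u. P a u")
    case True
    then obtain a u where "P a u" by blast
    have "MAW \<Sigma> (S @ [x]) - MAW \<Sigma> S \<subseteq>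
        fresh_extensions S x \<union> (\<lambda>b. (a # u) @ [b]) ` set (S @ [x])"
    proof
      fix w assume "w \<in> MAW \<Sigma> (S @ [x]) - MAW \<Sigma> S"
      then consider "w \<in> fresh_extensions S x"
        | a' u' b where "w = a' # u' @ [b]" "P a' u'" "b \<in> set (S @ [x])"
        using added by blast
      then show "w \<in> fresh_extensions S x \<union> (\<lambda>b. (a # u) @ [b]) ` set (S @ [x])"
      proof cases
        case (2 a' u' b)
        then have "w = (a # u) @ [b]" using P_unique[OF \<open>P a u\<close>, of a' u'] by simp
        with 2(3) show ?thesis by blast
      qed simp
    qed
    then show ?thesis by blast
  next
    case False
    then show ?thesis using added by blast
  qed
qed

lemma card_sym_diff_MAW_snoc:
  "card (sym_diff (MAW \<Sigma> S) (MAW \<Sigma> (S @ [x])))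
     \<le> 1 + card (set (S @ [x])) + card (fresh_extensions S x)"
proof -
  obtain v where v: "MAW \<Sigma> (S @ [x]) - MAW \<Sigma> S \<subseteq>
      fresh_extensions S x \<union> (\<lambda>b. v @ [b]) ` set (S @ [x])"
    using MAW_snoc_added[of \<Sigma> S x] by (elim exE)
  have "card (MAW \<Sigma> (S @ [x]) - MAW \<Sigma> S)
      \<le> card (fresh_extensions S x \<union> (\<lambda>b. v @ [b]) ` set (S @ [x]))"
    by (rule card_mono[OF _ v]) (simp add: finite_fresh_extensions)
  also have "\<dots> \<le> card (fresh_extensions S x) + card ((\<lambda>b. v @ [b]) ` set (S @ [x]))"
    by (rule card_Un_le)
  also have "\<dots> \<le> card (fresh_extensions S x) + card (set (S @ [x]))"
    by (intro add_left_mono card_image_le) auto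
  finally show ?thesis
    using card_removed[of \<Sigma> S x]
      card_Un_le[of "MAW \<Sigma> S - MAW \<Sigma> (S @ [x])" "MAW \<Sigma> (S @ [x]) - MAW \<Sigma> S"] by linarith
qed

section \<open>The upper bound\<close>

text \<open>Start positions count from 0, unlike those of \<open>substring\<close>.\<close>

abbreviation window :: "'a list \<Rightarrow> nat \<Rightarrow> nat \<Rightarrow> 'a list" where
  "window T d i \<equiv> take d (drop i T)"

lemma total_MAW_changes_window:
  assumes "1 \<le> d"
  shows "total_MAW_changes \<Sigma> T d =
    (\<Sum>i<length T - d. card (sym_diff (MAW \<Sigma> (window T d i)) (MAW \<Sigma> (window T d (Suc i)))))"
proof -
  have "total_MAW_changes \<Sigma> T d = (\<Sum>i\<in>{1..length T - d}.
      card (sym_diff (MAW \<Sigma> (window T d (i - 1))) (MAW \<Sigma> (window T d i))))"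
    unfolding total_MAW_changes_def using assms
    by (intro sum.cong) (auto simp: substring_def Suc_diff_le)
  also have "\<dots> = (\<Sum>i<length T - d. card (sym_diff (MAW \<Sigma> (window T d i)) (MAW \<Sigma> (window T d (Suc i)))))"
    by (rule sum.reindex_bij_witness[of _ Suc "\<lambda>i. i - 1"]) auto
  finally show ?thesis .
qed

lemma window_Suc_snoc:
  assumes "i < length T - d"
  shows "window T (Suc d) i = window T d i @ [T ! (i + d)]"
  using assms by (simp add: take_Suc_conv_app_nth)

lemma window_Suc_tl: "window T d (Suc i) = tl (window T (Suc d) i)"
  by (simp add: tl_take drop_Suc tl_drop)

lemma window_lists: "T \<in> lists \<Sigma> \<Longrightarrow> window T d i \<in> lists \<Sigma>"
  by (auto dest: in_set_takeD in_set_dropD)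

text \<open>Telescopes \<open>card_fresh_special\<close> over the first \<open>m\<close>
  slides.\<close>

lemma sum_fresh_special:
  assumes "m \<le> length T - d"
  shows "(\<Sum>i<m. card (fresh_special (window T d i) (T ! (i + d))))
           + card (left_special_suffixes (window T d m))
         \<le> card (left_special_suffixes (window T d 0)) + m"
  using assms
proof (induction m)
  case (Suc m)
  have "card (fresh_special (window T d m) (T ! (m + d)))
          + card (left_special_suffixes (window T d (Suc m)))
        \<le> card (left_special_suffixes (window T d m)) + 1"
    using card_fresh_special[of "window T d m" "T ! (m + d)"] window_Suc_snoc[of m T d] Suc.prems
    by (simp only: window_Suc_tl)
  with Suc show ?case by simp
qed simp

text \<open>Only the append half of each slide, ending in a window of length
  \<open>d + 1\<close>.\<close>

definition append_changes :: "'a set \<Rightarrow> 'a list \<Rightarrow> nat \<Rightarrow> nat" where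
  "append_changes \<Sigma> T d =
     (\<Sum>i<length T - d. card (sym_diff (MAW \<Sigma> (window T d i)) (MAW \<Sigma> (window T (Suc d) i))))"

lemma append_changes_le:
  assumes "finite \<Sigma>" "T \<in> lists \<Sigma>" "1 \<le> d" "d < length T"
  shows "append_changes \<Sigma> T d \<le> 4 * min d (card \<Sigma>) * length T"
proof -
  define m where "m = length T - d"
  define \<sigma> where "\<sigma> = card \<Sigma>"
  let ?N = "\<lambda>i. fresh_extensions (window T d i) (T ! (i + d))"
  let ?F = "\<lambda>i. fresh_special (window T d i) (T ! (i + d))"
  have T: "length T = m + d" using assms by (simp add: m_def)
  have "\<Sigma> \<noteq> {}" using assms by (cases T) auto
  then have \<sigma>: "1 \<le> \<sigma>" using assms by (simp add: \<sigma>_def Suc_leI card_gt_0_iff)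
  have step: "card (sym_diff (MAW \<Sigma> (window T d i)) (MAW \<Sigma> (window T (Suc d) i)))
      \<le> 1 + card (set (window T (Suc d) i)) + card (?N i)" if "i < m" for i
    using that card_sym_diff_MAW_snoc[of \<Sigma> "window T d i" "T ! (i + d)"]
    by (simp add: window_Suc_snoc m_def)
  \<comment> \<open>Each append costs at most \<open>1 + (d + 1) + d\<close>, which is at most
    \<open>4 * d\<close> because \<open>1 \<le> d\<close>.\<close>
  have "append_changes \<Sigma> T d \<le> (\<Sum>i<m. 4 * d)"
    unfolding append_changes_def m_def[symmetric]
  proof (rule sum_mono)
    fix i assume "i \<in> {..<m}"
    then have i: "i < m" by simp
    have "card (set (window T (Suc d) i)) \<le> Suc d"
      by (rule order_trans[OF card_length]) simp
    moreover have "card (?N i) \<le> d"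
      by (rule order_trans[OF card_fresh_extensions_le_length]) simp
    ultimately show "card (sym_diff (MAW \<Sigma> (window T d i)) (MAW \<Sigma> (window T (Suc d) i))) \<le> 4 * d"
      using step[OF i] assms(3) by linarith
  qed
  also have "\<dots> \<le> 4 * d * length T" by (simp add: T)
  finally have bound_d: "append_changes \<Sigma> T d \<le> 4 * d * length T" .
  \<comment> \<open>The initial potential is at most \<open>d + 1\<close>, so the fresh special
    suffixes number at most \<open>d + 1 + m\<close> in total.\<close>
  have "append_changes \<Sigma> T d \<le> (\<Sum>i<m. 2 * \<sigma> + \<sigma> * card (?F i))"
    unfolding append_changes_def m_def[symmetric]
  proof (rule sum_mono)
    fix i assume "i \<in> {..<m}"
    then have i: "i < m" by simp
    have "card (set (window T (Suc d) i)) \<le> \<sigma>"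
      using assms(1) window_lists[OF assms(2), of "Suc d" i] unfolding \<sigma>_def
      by (intro card_mono) auto
    moreover have "card (?N i) \<le> \<sigma> * card (?F i)"
      unfolding \<sigma>_def using assms(1) window_lists[OF assms(2)]
      by (rule card_fresh_extensions_le_special)
    ultimately show "card (sym_diff (MAW \<Sigma> (window T d i)) (MAW \<Sigma> (window T (Suc d) i)))
        \<le> 2 * \<sigma> + \<sigma> * card (?F i)"
      using step[OF i] \<sigma> by linarith
  qed
  also have "\<dots> = 2 * \<sigma> * m + \<sigma> * (\<Sum>i<m. card (?F i))"
    by (simp add: sum.distrib sum_distrib_left)
  also have "(\<Sum>i<m. card (?F i)) \<le> Suc d + m"
    using sum_fresh_special[of m T d] card_left_special_suffixes[of "window T d 0"] T by simp
  also have "2 * \<sigma> * m + \<sigma> * (Suc d + m) \<le> 4 * \<sigma> * length T"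
    using assms(3) unfolding T by (cases d) (simp_all add: algebra_simps)
  finally have "append_changes \<Sigma> T d \<le> 4 * \<sigma> * length T" by simp
  with bound_d show ?thesis by (auto simp: min_def \<sigma>_def)
qed

lemma window_rev:
  assumes "i + d \<le> length T"
  shows "window (rev T) d i = rev (window T d (length T - d - i))"
  using assms by (simp add: drop_rev take_rev drop_take add.commute[of i d])

text \<open>Reversal turns append number \<open>i\<close> in \<open>rev T\<close> into deletion
  number \<open>length T - d - 1 - i\<close> in \<open>T\<close>.\<close>

lemma delete_changes_eq:
  "(\<Sum>i<length T - d. card (sym_diff (MAW \<Sigma> (window T (Suc d) i)) (MAW \<Sigma> (window T d (Suc i)))))
     = append_changes \<Sigma> (rev T) d"
proof -
  let ?m = "length T - d"
  let ?del = "\<lambda>i. card (sym_diff (MAW \<Sigma> (window T (Suc d) i)) (MAW \<Sigma> (window T d (Suc i))))"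
  have step: "card (sym_diff (MAW \<Sigma> (window (rev T) d i)) (MAW \<Sigma> (window (rev T) (Suc d) i)))
      = ?del (?m - Suc i)" if "i < ?m" for i
  proof -
    have "window (rev T) d i = rev (window T d (Suc (?m - Suc i)))"
      using that by (subst window_rev) (simp_all add: Suc_diff_Suc)
    moreover have "window (rev T) (Suc d) i = rev (window T (Suc d) (?m - Suc i))"
      using that by (subst window_rev) simp_all
    ultimately show ?thesis by (simp only: MAW_rev card_sym_diff_rev Un_commute)
  qed
  have "append_changes \<Sigma> (rev T) d = (\<Sum>i<?m. ?del (?m - Suc i))"
    unfolding append_changes_def length_rev by (rule sum.cong) (simp_all only: step lessThan_iff)
  also have "\<dots> = (\<Sum>i<?m. ?del i)" by (rule sum.nat_diff_reindex)
  finally show ?thesis by (rule sym)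
qed

text \<open>The triangle inequality through the window of length \<open>d + 1\<close> splits a
  slide; appends and deletions contribute the factor 4 each.\<close>

lemma total_MAW_changes_le:
  assumes "finite \<Sigma>" "T \<in> lists \<Sigma>" "1 \<le> d" "d < length T"
  shows "total_MAW_changes \<Sigma> T d \<le> 8 * min d (card \<Sigma>) * length T"
proof -
  have "total_MAW_changes \<Sigma> T d \<le> (\<Sum>i<length T - d.
      card (sym_diff (MAW \<Sigma> (window T d i)) (MAW \<Sigma> (window T (Suc d) i)))
      + card (sym_diff (MAW \<Sigma> (window T (Suc d) i)) (MAW \<Sigma> (window T d (Suc i)))))"
    unfolding total_MAW_changes_window[OF assms(3)]
  proof (rule sum_mono)
    fix i
    have fin: "finite (MAW \<Sigma> S)" for S using assms(1) by (rule finite_MAW)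
    show "card (sym_diff (MAW \<Sigma> (window T d i)) (MAW \<Sigma> (window T d (Suc i))))
      \<le> card (sym_diff (MAW \<Sigma> (window T d i)) (MAW \<Sigma> (window T (Suc d) i)))
      + card (sym_diff (MAW \<Sigma> (window T (Suc d) i)) (MAW \<Sigma> (window T d (Suc i))))"
      using fin fin fin by (rule card_sym_diff_triangle)
  qed
  also have "\<dots> = append_changes \<Sigma> T d + append_changes \<Sigma> (rev T) d"
    by (simp only: sum.distrib append_changes_def[of \<Sigma> T] delete_changes_eq)
  finally have "total_MAW_changes \<Sigma> T d \<le> append_changes \<Sigma> T d + append_changes \<Sigma> (rev T) d" .
  moreover have "append_changes \<Sigma> (rev T) d \<le> 4 * min d (card \<Sigma>) * length T"
    using append_changes_le[of \<Sigma> "rev T" d] assms by (simp add: in_lists_conv_set)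
  ultimately show ?thesis using append_changes_le[OF assms] by simp
qed

section \<open>The lower bound\<close>

text \<open>A shortest factor of \<open>S'\<close> that does not occur in \<open>S\<close> would be
  a minimal absent word for \<open>S\<close> but not for \<open>S'\<close>.\<close>

lemma MAW_eq_imp_sublist:
  assumes "MAW \<Sigma> S = MAW \<Sigma> S'" "S' \<in> lists \<Sigma>"
  shows "sublist S' S"
proof (rule ccontr)
  assume "\<not> sublist S' S"
  then have "sublist S' S' \<and> \<not> sublist S' S" by simp
  from ex_has_least_nat[of "\<lambda>w. sublist w S' \<and> \<not> sublist w S", OF this, of length]
  obtain w where w: "sublist w S'" "\<not> sublist w S"
    and least: "\<And>v. sublist v S' \<Longrightarrow> \<not> sublist v S \<Longrightarrow> length w \<le> length v"
    by blast
  have "sublist u S" if u: "strict_sublist u w" for u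
  proof (rule ccontr)
    assume "\<not> sublist u S"
    moreover have "sublist u S'"
      using u w(1) sublist_order.order_trans by (auto simp: strict_sublist_def)
    ultimately have "length w \<le> length u" by (rule least[rotated])
    moreover have "length u < length w"
      using u by (auto simp: strict_sublist_def sublist_def)
    ultimately show False by simp
  qed
  moreover have "w \<in> lists \<Sigma>" using set_mono_sublist[OF w(1)] assms(2) by auto
  ultimately have "w \<in> MAW \<Sigma> S" using w(2) by (auto simp: MAW_def)
  with assms(1) have "\<not> sublist w S'" by (simp add: MAW_def)
  with w(1) show False by simp
qed

lemma MAW_eq_imp_eq:
  assumes "MAW \<Sigma> S = MAW \<Sigma> S'" "S \<in> lists \<Sigma>" "S' \<in> lists \<Sigma>"
  shows "S = S'"
  using assms MAW_eq_imp_sublist[of \<Sigma> S S'] MAW_eq_imp_sublist[of \<Sigma> S' S]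
    sublist_order.order.antisym by auto

text \<open>Consecutive windows begin with different letters; a string is determined by its minimal
  absent words, so every slide changes at least one.\<close>

lemma total_MAW_changes_alternating:
  assumes "finite \<Sigma>" "1 \<le> d" "d < n" "{0, 1} \<subseteq> \<Sigma>"
  shows "total_MAW_changes \<Sigma> (map (\<lambda>i. i mod 2) [0..<n]) d \<ge> n - d"
proof -
  let ?T = "map (\<lambda>i. i mod 2) [0..<n] :: nat list"
  have T: "?T \<in> lists \<Sigma>" using assms(4) by (auto simp: mod2_eq_if)
  have "1 \<le> card (sym_diff (MAW \<Sigma> (window ?T d i)) (MAW \<Sigma> (window ?T d (Suc i))))"
    if i: "i < n - d" for i
  proof -
    have "window ?T d i ! 0 \<noteq> window ?T d (Suc i) ! 0"
    proof -
      from i have "Suc i < n" using assms(2) by simp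
      then show ?thesis using i assms(2) by (simp add: mod_Suc)
    qed
    then have "MAW \<Sigma> (window ?T d i) \<noteq> MAW \<Sigma> (window ?T d (Suc i))"
      using MAW_eq_imp_eq window_lists[OF T] by metis
    then have "sym_diff (MAW \<Sigma> (window ?T d i)) (MAW \<Sigma> (window ?T d (Suc i))) \<noteq> {}" by blast
    then show ?thesis
      using finite_MAW[OF assms(1)] by (simp add: Suc_leI card_gt_0_iff)
  qed
  then have "(\<Sum>i<n - d. 1) \<le>
      (\<Sum>i<n - d. card (sym_diff (MAW \<Sigma> (window ?T d i)) (MAW \<Sigma> (window ?T d (Suc i)))))"
    by (intro sum_mono) simp
  then show ?thesis using assms(2) by (simp add: total_MAW_changes_window)
qed

section \<open>Strings with cyclic markers separated by blocks of zeros\<close>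

definition block_letter :: "nat \<Rightarrow> nat \<Rightarrow> nat \<Rightarrow> nat" where
  "block_letter p q i = (if q dvd i then Suc ((i div q) mod p) else 0)"

text \<open>The string \<open>1 0\<^sup>k 2 0\<^sup>k \<dots>\<close> cut to length
  \<open>n\<close>, with \<open>k = q - 1\<close> and \<open>p\<close> markers; 0 is reserved for
  the filler, so \<open>p\<close> will be \<open>\<sigma> - 1\<close>.\<close>

definition block_string :: "nat \<Rightarrow> nat \<Rightarrow> nat \<Rightarrow> nat list" where
  "block_string p q n = map (block_letter p q) [0..<n]"

lemma window_block_string:
  assumes "i + d \<le> n"
  shows "window (block_string p q n) d i = map (block_letter p q) [i..<i + d]"
  using assms by (simp add: block_string_def drop_map take_map)

text \<open>The bound \<open>max i j\<close> covers \<open>j < i\<close>, where only the empty word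
  occurs, with witness \<open>k = i\<close>.\<close>

lemma sublist_map_upt_iff:
  "sublist w (map f [i..<j]) \<longleftrightarrow>
     (\<exists>k\<ge>i. k + length w \<le> max i j \<and> w = map f [k..<k + length w])" for f :: "nat \<Rightarrow> 'a"
proof
  assume "sublist w (map f [i..<j])"
  then obtain ps ss where e: "map f [i..<j] = ps @ w @ ss" by (auto simp: sublist_def)
  have len: "j - i = length ps + length w + length ss"
    using arg_cong[OF e, of length] by simp
  have "w = take (length w) (drop (length ps) (map f [i..<j]))" by (simp add: e)
  also have "\<dots> = map f [i + length ps..<i + length ps + length w]"
  proof -
    have "take (length w) [i + length ps..<j] = [i + length ps..<i + length ps + length w]"
    proof (cases "length w = 0")
      case False
      with len have "i + length ps + length w \<le> j" by linarith
      then show ?thesis by (rule take_upt)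
    qed simp
    then show ?thesis by (simp only: drop_map take_map drop_upt)
  qed
  finally show "\<exists>k\<ge>i. k + length w \<le> max i j \<and> w = map f [k..<k + length w]"
    using len by (intro exI[of _ "i + length ps"]) auto
next
  assume "\<exists>k\<ge>i. k + length w \<le> max i j \<and> w = map f [k..<k + length w]"
  then obtain k where k: "i \<le> k" "k + length w \<le> max i j" "w = map f [k..<k + length w]"
    by blast
  show "sublist w (map f [i..<j])"
  proof (cases "i \<le> j")
    case True
    with k have "k + length w \<le> j" by simp
    then have "take (length w) (drop (k - i) [i..<j]) = [k..<k + length w]"
      using k(1) by (simp add: take_upt)
    then have "w = take (length w) (drop (k - i) (map f [i..<j]))"
      using k(3) by (simp only: drop_map take_map)
    then show ?thesis
      using sublist_order.order_trans[OF sublist_take sublist_drop] by metis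
  next
    case False
    with k(2) have "k + length w \<le> i" by simp
    with k(1) have "length w = 0" by linarith
    then show ?thesis by simp
  qed
qed

lemma sublist_map_upt:
  assumes "i \<le> k" "k \<le> l" "l \<le> j"
  shows "sublist (map f [k..<l]) (map f [i..<j])"
  using assms by (auto simp: sublist_map_upt_iff intro!: exI[of _ k])

lemma mod_less_period_eq:
  assumes "s \<le> t" "t < s + p" "t mod p = s mod p"
  shows "t = (s::nat)"
proof -
  from assms have "p dvd t - s" by (simp add: mod_eq_dvd_iff_nat)
  moreover have "t - s < p" using assms by simp
  ultimately show ?thesis using assms(1) by (auto dest: dvd_imp_le)
qed

text \<open>The argument is a pair so that the lost words can be counted as a product set.\<close>

definition lost_word :: "nat \<Rightarrow> nat \<Rightarrow> nat \<Rightarrow> nat \<times> nat \<Rightarrow> nat list" where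
  "lost_word p q s = (\<lambda>(j, t). Suc (s mod p) # replicate j 0 @ [Suc ((s + t) mod p)])"

lemma block_letter_first: "0 < q \<Longrightarrow> block_letter p q (s * q) = Suc (s mod p)"
  by (simp add: block_letter_def)

lemma block_letter_zero:
  assumes "s * q < i" "i < Suc s * q"
  shows "block_letter p q i = 0"
proof -
  have "\<not> q dvd i"
  proof
    assume "q dvd i"
    then obtain k where "i = q * k" by blast
    with assms have "s * q < k * q" "k * q < Suc s * q" by (simp_all only: mult.commute)
    then have "s < k" "k < Suc s" by (simp_all only: mult_less_cancel2)
    then show False by simp
  qed
  then show ?thesis by (simp add: block_letter_def)
qed

lemma map_block_letter_zero:
  assumes "s * q < i" "j \<le> Suc s * q"
  shows "map (block_letter p q) [i..<j] = replicate (j - i) 0"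
  using assms by (intro nth_equalityI) (auto intro!: block_letter_zero[of s])

text \<open>As \<open>d < p * q\<close>, the letter of marker \<open>s\<close> occurs in the first
  window only at its start, and nowhere in the second. After it come \<open>q - 1\<close> zeros and
  marker \<open>s + 1\<close>, whose letter differs from that of marker \<open>s + t\<close> since
  \<open>2 \<le> t < p\<close>.\<close>

lemma lost_word_lost:
  assumes pq: "d < p * q" and j: "j < q" and t: "2 \<le> t" "t * q < d" and n: "s * q + d < n"
    and \<Sigma>: "{..p} \<subseteq> \<Sigma>"
  shows "lost_word p q s (j, t) \<in> MAW \<Sigma> (window (block_string p q n) d (s * q))
           - MAW \<Sigma> (window (block_string p q n) d (Suc (s * q)))"
proof -
  let ?f = "block_letter p q" and ?a = "Suc (s mod p)" and ?b = "Suc ((s + t) mod p)"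
  let ?S = "map ?f [s * q..<s * q + d]" and ?S' = "map ?f [Suc (s * q)..<Suc (s * q) + d]"
  have q: "0 < q" and p: "0 < p" using pq j by (auto intro: gr0I)
  have "t * q < p * q" using t(2) pq by (rule less_trans)
  then have tp: "t < p" by simp
  have qt: "q \<le> t * q" using t(1) by simp
  \<comment> \<open>The range includes \<open>s * q + d\<close>, the last position of the shifted
    window, so one fact serves both windows.\<close>
  have marker: "x = s * q" if x: "s * q \<le> x" "x \<le> s * q + d" "?f x = ?a" for x
  proof -
    from x(3) obtain k where k: "x = k * q" "k mod p = s mod p"
      using q by (auto simp: block_letter_def split: if_splits)
    from x(1) k(1) q have "s \<le> k" by simp
    moreover have "k * q < (s + p) * q"
      using x(2) k(1) pq by (simp add: add_mult_distrib)
    then have "k < s + p" by simp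
    ultimately show ?thesis using mod_less_period_eq[of s k p] k by simp
  qed
  have w: "lost_word p q s (j, t) = ?a # replicate j 0 @ [?b]" by (simp add: lost_word_def)
  have left: "?a # replicate j 0 = map ?f [s * q..<s * q + Suc j]"
    using q j by (simp add: upt_rec[of "s * q"] block_letter_first map_block_letter_zero[of s] del: upt_Suc)
  have right: "replicate j 0 @ [?b] = map ?f [(s + t) * q - j..<Suc ((s + t) * q)]"
  proof -
    have "q \<le> (s + t) * q" using t by simp
    moreover have "(s + t - 1) * q = (s + t) * q - q" by (simp add: diff_mult_distrib)
    ultimately have "(s + t - 1) * q < (s + t) * q - j" "j \<le> (s + t) * q" using j by linarith+
    then show ?thesis
      using q t by (simp add: map_block_letter_zero[of "s + t - 1"] block_letter_first)
  qed
  have "\<not> sublist (?a # replicate j 0 @ [?b]) ?S"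
  proof
    assume "sublist (?a # replicate j 0 @ [?b]) ?S"
    then obtain x where x: "s * q \<le> x" "x + (j + 2) \<le> s * q + d"
      and e: "?a # replicate j 0 @ [?b] = map ?f [x..<x + (j + 2)]"
      by (auto simp: sublist_map_upt_iff)
    have first: "?f x = ?a" using arg_cong[OF e, of "\<lambda>l. l ! 0"] by (simp del: upt_Suc)
    then have xs: "x = s * q" using x by (intro marker) auto
    have last: "?f (x + Suc j) = ?b"
      using arg_cong[OF e, of "\<lambda>l. l ! Suc j"] by (simp add: nth_append del: upt_Suc)
    \<comment> \<open>The letter \<open>?b\<close> is nonzero, so it cannot lie in the block of
      zeros after marker \<open>s\<close>; it must be marker \<open>s + 1\<close>.\<close>
    have "\<not> s * q + Suc j < Suc s * q"
      using last block_letter_zero[of s q "s * q + Suc j" p] xs by auto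
    with j have "Suc j = q" by simp
    with xs have "x + Suc j = Suc s * q" by simp
    with last have "?f (Suc s * q) = ?b" by (simp only:)
    with block_letter_first[OF q, of p "Suc s"] have "Suc s mod p = (s + t) mod p"
      by (simp only: nat.inject)
    then have "s + t = Suc s"
      using mod_less_period_eq[of "Suc s" "s + t" p] t tp by simp
    with t show False by simp
  qed
  moreover have "sublist (?a # replicate j 0) ?S"
    unfolding left by (rule sublist_map_upt) (use j t qt in linarith)+
  moreover have "sublist (replicate j 0 @ [?b]) ?S"
    unfolding right
    by (rule sublist_map_upt) (use j t qt add_mult_distrib[of s t q] in linarith)+
  moreover have "?a # replicate j 0 @ [?b] \<in> lists \<Sigma>"
  proof -
    have "?a \<le> p" "?b \<le> p" using p by (simp_all add: Suc_leI)
    then show ?thesis using \<Sigma> by (auto simp: subset_iff)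
  qed
  moreover have "\<not> sublist (?a # replicate j 0) ?S'"
  proof
    assume "sublist (?a # replicate j 0) ?S'"
    then have "?a \<in> set ?S'" using set_mono_sublist by fastforce
    then obtain x where "?f x = ?a" and "x \<in> set [Suc (s * q)..<Suc (s * q) + d]"
      by (metis imageE set_map)
    then have "Suc (s * q) \<le> x" "x \<le> s * q + d" by (simp_all add: less_Suc_eq_le del: upt_Suc)
    with \<open>?f x = ?a\<close> marker[of x] show False by simp
  qed
  ultimately show ?thesis
    using n by (simp add: window_block_string w MAW_Cons_snoc_iff)
qed

lemma inj_on_lost_word: "inj_on (lost_word p q s) ({..<q} \<times> {2..<p})"
proof (rule inj_onI)
  fix x y
  assume xy: "x \<in> {..<q} \<times> {2..<p}" "y \<in> {..<q} \<times> {2..<p}"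
    and e: "lost_word p q s x = lost_word p q s y"
  obtain j t j' t' where x: "x = (j, t)" and y: "y = (j', t')" by (cases x, cases y)
  have t: "t < p" "t' < p" using xy x y by simp_all
  have m: "(s + t) mod p = (s + t') mod p" using e by (simp add: lost_word_def x y)
  from arg_cong[OF e, of length] have "j = j'" by (simp add: lost_word_def x y)
  moreover have "t = t'"
  proof (cases "t \<le> t'")
    case True
    then show ?thesis using mod_less_period_eq[of "s + t" "s + t'" p] m t by simp
  next
    case False
    then show ?thesis using mod_less_period_eq[of "s + t'" "s + t" p] m t by simp
  qed
  ultimately show "x = y" using x y by simp
qed

text \<open>There are \<open>q\<close> choices of \<open>j\<close>, and \<open>t\<close> runs from 2
  to \<open>(d - 1) div q\<close>, the largest value with \<open>t * q < d\<close>.\<close>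

lemma card_lost:
  assumes pq: "d < p * q" and q: "0 < q" and d: "0 < d" and n: "s * q + d < n"
    and \<Sigma>: "finite \<Sigma>" "{..p} \<subseteq> \<Sigma>"
  shows "q * ((d - 1) div q - 1) \<le>
    card (sym_diff (MAW \<Sigma> (window (block_string p q n) d (s * q)))
                   (MAW \<Sigma> (window (block_string p q n) d (Suc (s * q)))))"
proof -
  let ?m = "(d - 1) div q"
  have t: "t * q < d" if "t \<le> ?m" for t
    using that q d by (simp add: less_eq_div_iff_mult_less_eq) 
  have "?m < p" using pq q d
    by (metis diff_le_self div_less_iff_less_mult le_less_trans)
  then have sub: "{..<q} \<times> {2..?m} \<subseteq> {..<q} \<times> {2..<p}" by auto
  have "q * (?m - 1) = card ({..<q} \<times> {2..?m})"
    by (simp add: card_cartesian_product)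
  also have "\<dots> = card (lost_word p q s ` ({..<q} \<times> {2..?m}))"
    by (rule card_image[symmetric]) (rule inj_on_subset[OF inj_on_lost_word sub])
  also have "\<dots> \<le> card (sym_diff (MAW \<Sigma> (window (block_string p q n) d (s * q)))
                   (MAW \<Sigma> (window (block_string p q n) d (Suc (s * q)))))"
    using lost_word_lost[OF pq _ _ t n \<Sigma>(2)] finite_MAW[OF \<Sigma>(1)]
    by (intro card_mono) auto
  finally show ?thesis .
qed

lemma total_MAW_changes_block_string:
  assumes pq: "d < p * q" and q: "0 < q" and d: "0 < d" and n: "d < n"
    and \<Sigma>: "finite \<Sigma>" "{..p} \<subseteq> \<Sigma>"
  shows "(n - d) * ((d - 1) div q - 1) \<le> total_MAW_changes \<Sigma> (block_string p q n) d"
proof -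
  let ?c = "\<lambda>i. card (sym_diff (MAW \<Sigma> (window (block_string p q n) d i))
                   (MAW \<Sigma> (window (block_string p q n) d (Suc i))))"
  \<comment> \<open>This is \<open>(n - d) / q\<close> rounded up, the number of slides that drop a
    marker. Only these are counted, and each loses \<open>q\<close> words per admissible
    \<open>t\<close>.\<close>
  define r where "r = Suc ((n - d - 1) div q)"
  have s: "s * q < n - d" if "s < r" for s
    using that q n by (simp add: r_def less_Suc_eq_le less_eq_div_iff_mult_less_eq)
  have "n - d \<le> r * q"
    using n dividend_less_times_div[OF q, of "n - d - 1"] by (simp add: r_def mult.commute)
  then have "(n - d) * ((d - 1) div q - 1) \<le> (r * q) * ((d - 1) div q - 1)"
    by (rule mult_le_mono1)
  also have "\<dots> = (\<Sum>s<r. q * ((d - 1) div q - 1))" by simp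
  also have "\<dots> \<le> (\<Sum>s<r. ?c (s * q))"
  proof (rule sum_mono)
    fix s assume "s \<in> {..<r}"
    then have "s * q + d < n" using s[of s] by simp
    then show "q * ((d - 1) div q - 1) \<le> ?c (s * q)" by (rule card_lost[OF pq q d _ \<Sigma>])
  qed
  also have "\<dots> = sum ?c ((\<lambda>s. s * q) ` {..<r})"
    using q by (subst sum.reindex) (auto simp: inj_on_def)
  also have "\<dots> \<le> sum ?c {..<n - d}"
    using s by (intro sum_mono2) auto
  also have "\<dots> = total_MAW_changes \<Sigma> (block_string p q n) d"
    using d by (simp add: total_MAW_changes_window block_string_def)
  finally show ?thesis .
qed

text \<open>With \<open>p = \<sigma> - 1\<close>, the spacing \<open>d div p + 1\<close> is the
  least \<open>q\<close> with \<open>d < p * q\<close>. If \<open>d < p\<close>, then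
  \<open>q = 1\<close>; otherwise \<open>p * q \<le> 2 * d\<close>, so the window still spans about
  half a cycle.\<close>

lemma block_count_ge:
  assumes "16 \<le> d" "16 \<le> (\<sigma>::nat)"
  shows "min d \<sigma> \<le> 16 * ((d - 1) div (d div (\<sigma> - 1) + 1) - 1)"
proof -
  define p q where "p = \<sigma> - 1" and "q = d div p + 1"
  have p: "15 \<le> p" using assms by (simp add: p_def)
  show ?thesis
  proof (cases "d < p")
    case True
    then show ?thesis using assms p by (simp add: p_def)
  next
    case False
    define m where "m = (d - 1) div q"
    have "p * q \<le> 2 * d"
    proof -
      have "p * q = p + p * (d div p)" by (simp add: q_def)
      then show ?thesis using False times_div_less_eq_dividend[of p d] by linarith
    qed
    moreover have "d \<le> (m + 1) * q"
      using assms dividend_less_times_div[of q "d - 1"] by (simp add: m_def q_def mult.commute)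
    ultimately have "p * q \<le> 2 * (m + 1) * q" by linarith
    moreover have "0 < q" by (simp add: q_def)
    ultimately have "p \<le> 2 * (m + 1)" by (simp only: mult_le_cancel2)
    then have "\<sigma> \<le> 16 * (m - 1)" using p assms by (simp add: p_def)
    then show ?thesis by (simp add: m_def q_def p_def)
  qed
qed

lemma exists_many_MAW_changes:
  assumes "2 \<le> \<sigma>" "1 \<le> d" "d < n"
  shows "\<exists>T \<in> lists {..<\<sigma>}. length T = n \<and>
    (n - d) * min d \<sigma> \<le> 16 * total_MAW_changes {..<\<sigma>} T d"
\<comment> \<open>Below the threshold \<open>min d \<sigma>\<close> is less than 16, so one change
  per slide suffices.\<close>
proof (cases "d < 16 \<or> \<sigma> < 16")
  case True
  let ?T = "map (\<lambda>i. i mod 2) [0..<n] :: nat list"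
  have "n - d \<le> total_MAW_changes {..<\<sigma>} ?T d"
    using assms by (intro total_MAW_changes_alternating) auto
  then have "(n - d) * min d \<sigma> \<le> total_MAW_changes {..<\<sigma>} ?T d * 16"
    using True by (intro mult_le_mono) auto
  moreover have "?T \<in> lists {..<\<sigma>}" using assms(1) by (auto simp: mod2_eq_if)
  ultimately show ?thesis by (intro bexI[of _ ?T]) simp_all
next
  case False
  define p q where "p = \<sigma> - 1" and "q = d div p + 1"
  let ?T = "block_string p q n"
  have p: "0 < p" using assms by (simp add: p_def)
  have pq: "d < p * q" using dividend_less_times_div[OF p, of d] by (simp add: q_def)
  have "(n - d) * min d \<sigma> \<le> (n - d) * (16 * ((d - 1) div q - 1))"
    using block_count_ge[of d \<sigma>] False unfolding q_def p_def by (intro mult_le_mono2) auto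
  also have "\<dots> \<le> 16 * total_MAW_changes {..<\<sigma>} ?T d"
  proof -
    have "{..p} \<subseteq> {..<\<sigma>}" using assms by (auto simp: p_def)
    then have "(n - d) * ((d - 1) div q - 1) \<le> total_MAW_changes {..<\<sigma>} ?T d"
      using assms by (intro total_MAW_changes_block_string[OF pq]) (auto simp: q_def)
    then show ?thesis by simp
  qed
  finally have "(n - d) * min d \<sigma> \<le> 16 * total_MAW_changes {..<\<sigma>} ?T d" .
  moreover have "?T \<in> lists {..<\<sigma>}"
    using p assms(1) mod_less_divisor[OF p] by (auto simp: block_string_def block_letter_def p_def less_diff_conv)
  ultimately show ?thesis by (intro bexI[of _ ?T]) (simp_all add: block_string_def)
qed

text \<open>The lower bound starts at \<open>\<sigma> = 2\<close>: over a single letter all windows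
  coincide and the sum is 0.\<close>

theorem theorem3:
  shows "(\<exists>C::real. \<forall>(\<Sigma>::nat set) (T::nat list) (d::nat).
            finite \<Sigma> \<longrightarrow> T \<in> lists \<Sigma> \<longrightarrow> 1 \<le> d \<longrightarrow> d < length T \<longrightarrow>
            real (total_MAW_changes \<Sigma> T d) \<le> C * real (min d (card \<Sigma>)) * real (length T))
       \<and> (\<forall>c::real. 0 < c \<and> c < 1 \<longrightarrow>
            (\<exists>c'::real. c' > 0 \<and>
              (\<forall>(\<sigma>::nat) (d::nat) (n::nat).
                 2 \<le> \<sigma> \<longrightarrow> 1 \<le> d \<longrightarrow> d < n \<longrightarrow> real n - real d \<ge> c * real n \<longrightarrow>
                 (\<exists>(\<Sigma>::nat set) (T::nat list).
                    finite \<Sigma> \<and> card \<Sigma> = \<sigma> \<and> T \<in> lists \<Sigma> \<and> length T = n \<and>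
                    real (total_MAW_changes \<Sigma> T d) \<ge> c' * real (min d \<sigma>) * real n))))"
proof (rule conjI)
  show "\<exists>C::real. \<forall>(\<Sigma>::nat set) (T::nat list) (d::nat).
            finite \<Sigma> \<longrightarrow> T \<in> lists \<Sigma> \<longrightarrow> 1 \<le> d \<longrightarrow> d < length T \<longrightarrow>
            real (total_MAW_changes \<Sigma> T d) \<le> C * real (min d (card \<Sigma>)) * real (length T)"
  proof (intro exI[of _ 8] allI impI)
    fix \<Sigma> :: "nat set" and T :: "nat list" and d :: nat
    assume "finite \<Sigma>" "T \<in> lists \<Sigma>" "1 \<le> d" "d < length T"
    then have "total_MAW_changes \<Sigma> T d \<le> 8 * min d (card \<Sigma>) * length T"
      by (rule total_MAW_changes_le)
    from of_nat_mono[OF this, where 'a = real]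
    show "real (total_MAW_changes \<Sigma> T d) \<le> 8 * real (min d (card \<Sigma>)) * real (length T)"
      by (simp only: of_nat_mult of_nat_numeral)
  qed
next
  show "\<forall>c::real. 0 < c \<and> c < 1 \<longrightarrow>
            (\<exists>c'::real. c' > 0 \<and>
              (\<forall>(\<sigma>::nat) (d::nat) (n::nat).
                 2 \<le> \<sigma> \<longrightarrow> 1 \<le> d \<longrightarrow> d < n \<longrightarrow> real n - real d \<ge> c * real n \<longrightarrow>
                 (\<exists>(\<Sigma>::nat set) (T::nat list).
                    finite \<Sigma> \<and> card \<Sigma> = \<sigma> \<and> T \<in> lists \<Sigma> \<and> length T = n \<and>
                    real (total_MAW_changes \<Sigma> T d) \<ge> c' * real (min d \<sigma>) * real n)))"
  proof (intro allI impI)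
    fix c :: real
    assume c: "0 < c \<and> c < 1"
    \<comment> \<open>The constant \<open>c / 16\<close> combines \<open>n - d \<ge> c * n\<close>
      with the factor 16 of \<open>exists_many_MAW_changes\<close>.\<close>
    have "\<exists>(\<Sigma>::nat set) (T::nat list). finite \<Sigma> \<and> card \<Sigma> = \<sigma> \<and> T \<in> lists \<Sigma> \<and> length T = n \<and>
        real (total_MAW_changes \<Sigma> T d) \<ge> c / 16 * real (min d \<sigma>) * real n"
      if h: "2 \<le> \<sigma>" "1 \<le> d" "d < n" "real n - real d \<ge> c * real n" for \<sigma> d n
    proof -
      obtain T where T: "T \<in> lists {..<\<sigma>}" "length T = n"
        and le: "(n - d) * min d \<sigma> \<le> 16 * total_MAW_changes {..<\<sigma>} T d"
        using exists_many_MAW_changes[OF h(1-3)] by blast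
      have "c * real n * real (min d \<sigma>) \<le> real (n - d) * real (min d \<sigma>)"
        using h by (intro mult_right_mono) (simp_all add: of_nat_diff)
      also have "\<dots> \<le> 16 * real (total_MAW_changes {..<\<sigma>} T d)"
        using of_nat_mono[OF le, where 'a = real] by (simp only: of_nat_mult of_nat_numeral)
      finally have "c / 16 * real (min d \<sigma>) * real n \<le> real (total_MAW_changes {..<\<sigma>} T d)"
        by (simp add: mult_ac)
      with T show ?thesis by (intro exI[of _ "{..<\<sigma>}"] exI[of _ T]) simp
    qed
    with c show "\<exists>c'::real. c' > 0 \<and>
              (\<forall>(\<sigma>::nat) (d::nat) (n::nat).
                 2 \<le> \<sigma> \<longrightarrow> 1 \<le> d \<longrightarrow> d < n \<longrightarrow> real n - real d \<ge> c * real n \<longrightarrow>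
                 (\<exists>(\<Sigma>::nat set) (T::nat list).
                    finite \<Sigma> \<and> card \<Sigma> = \<sigma> \<and> T \<in> lists \<Sigma> \<and> length T = n \<and>
                    real (total_MAW_changes \<Sigma> T d) \<ge> c' * real (min d \<sigma>) * real n))"
      by (intro exI[of _ "c / 16"]) simp
  qed
qed

end
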